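(* Let $(X,w)$ be a weighted graph and let $R$ be a nontrivial (additive) abelian group. Then $$\tfrac{1}{2}h(X,w)\;\leq\; h'(X,w)\;\leq\; \mathrm{cbe}_0(X,w,R_X)\;\leq\; h(X,w).$$
   Context: A graph is a finite simplicial complex $X$ of dimension at most $1$ (a nonempty finite family of finite sets closed under taking subsets, so $\emptyset\in X$). $X(i)$ denotes the set of faces of dimension $i$ (i.e. of cardinality $i+1$); $X(0)$ is the set of vertices ($0$-faces) and $X(1)$ the set of edges. A weighted graph is a pair $(X,w)$ where $X$ is a graph that is pure of dimension $1$ (every face is contained in an edge) and $w:X\to[0,\infty)$ satisfies $\sum_{e\in X(1)}w(e)=1$, $w(v)=\frac12\sum_{e\in X(1),\,e\supseteq v}w(e)$ for all $v\in X(0)$, $w(\emptyset)=1$, and $w(v)>0$ for all $v\in X(0)$. For $A\subseteq X$, $w(A)=\sum_{a\in A}w(a)$. For $A,B\subseteq X(0)$, $E(A,B)$ is the set of edges with one vertex in $A$ and the other in $B$. Cheeger constants: $$h(X,w)=\min_{\emptyset\neq A\subsetneq X(0)}\frac{w(E(A,X(0)-A))}{\min\{w(A),w(X(0)-A)\}},\qquad h'(X,w)=\min_{\emptyset\neq A\subsetneq X(0)}\frac{w(E(A,X(0)-A))}{2\,w(A)\,w(X(0)-A)}.$$ Coboundary expansion with constant coefficients: fix a linear order on the vertices and, for an edge $e$, let $e^+$ and $e^-$ be its larger and smaller vertex. Let $C^0=R^{X(0)}$ and $C^1=R^{X(1)}$, let $d_0:C^0\to C^1$ be $(d_0f)(e)=f(e^+)-f(e^-)$,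 and let $B^0\subseteq C^0$ be the set of constant functions $X(0)\to R$. For $f\in C^i$ put $\|f\|_w=w(\{x\in X(i): f(x)\neq 0\})$ and $\mathrm{dist}_w(f,B^0)=\min_{g\in B^0}\|f-g\|_w$. Then $\mathrm{cbe}_0(X,w,R_X)$ is the supremum of all $\varepsilon\in[0,\infty)$ such that $\|d_0f\|_w\ge\varepsilon\,\mathrm{dist}_w(f,B^0)$ for all $f\in C^0$. (Here $R_X$ denotes the constant sheaf on $X$ associated to $R$.) *)

theory Defs
  imports Complex_Main "HOL-Library.Extended_Real" "HOL-Library.FuncSet"
begin

definition simplicial_complex :: "'a set set \<Rightarrow> bool" where
  "simplicial_complex X \<longleftrightarrow>
     X \<noteq> {} \<and> finite X \<and> (\<forall>x\<in>X. finite x) \<and> (\<forall>x\<in>X. \<forall>y. y \<subseteq> x \<longrightarrow> y \<in> X)"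

(* Vertices are 0-faces, i.e. singletons {v}, as in the simplicial convention;
   hence "v is a vertex of e" reads v \<subseteq> e. *)
definition faces :: "'a set set \<Rightarrow> nat \<Rightarrow> 'a set set" where
  "faces X i = {x \<in> X. card x = i + 1}"

definition graph :: "'a set set \<Rightarrow> bool" where
  "graph X \<longleftrightarrow> simplicial_complex X \<and> (\<forall>x\<in>X. card x \<le> 2)"

definition pure1 :: "'a set set \<Rightarrow> bool" where
  "pure1 X \<longleftrightarrow> (\<forall>x\<in>X. \<exists>e\<in>faces X 1. x \<subseteq> e)"

(* The values of w outside X are irrelevant. *)
definition weighted_graph :: "'a set set \<Rightarrow> ('a set \<Rightarrow> real) \<Rightarrow> bool" where
  "weighted_graph X w \<longleftrightarrow>
     graph X \<and> pure1 X \<and>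
     (\<forall>x\<in>X. 0 \<le> w x) \<and>
     (\<Sum>e\<in>faces X 1. w e) = 1 \<and>
     (\<forall>v\<in>faces X 0. w v = 1 / 2 * (\<Sum>e\<in>{e \<in> faces X 1. v \<subseteq> e}. w e)) \<and>
     w {} = 1 \<and>
     (\<forall>v\<in>faces X 0. 0 < w v)"

definition weight :: "('a set \<Rightarrow> real) \<Rightarrow> 'a set set \<Rightarrow> real" where
  "weight w A = (\<Sum>a\<in>A. w a)"

(* Since e has two elements, e = a \<union> b forces the vertices a and b to be distinct. *)
definition edges_between :: "'a set set \<Rightarrow> 'a set set \<Rightarrow> 'a set set \<Rightarrow> 'a set set" where
  "edges_between X A B = {e \<in> faces X 1. \<exists>a\<in>A. \<exists>b\<in>B. e = a \<union> b}"

definition cheeger :: "'a set set \<Rightarrow> ('a set \<Rightarrow> real) \<Rightarrow> real" where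
  "cheeger X w =
     Min {weight w (edges_between X A (faces X 0 - A)) /
            min (weight w A) (weight w (faces X 0 - A)) |A. A \<noteq> {} \<and> A \<subset> faces X 0}"

definition cheeger' :: "'a set set \<Rightarrow> ('a set \<Rightarrow> real) \<Rightarrow> real" where
  "cheeger' X w =
     Min {weight w (edges_between X A (faces X 0 - A)) /
            (2 * weight w A * weight w (faces X 0 - A)) |A. A \<noteq> {} \<and> A \<subset> faces X 0}"

definition cochains :: "'a set set \<Rightarrow> nat \<Rightarrow> ('a set \<Rightarrow> 'r) set" where
  "cochains X i = (faces X i \<rightarrow>\<^sub>E UNIV)"

definition constants :: "'a set set \<Rightarrow> ('a set \<Rightarrow> 'r) set" where
  "constants X = {restrict (\<lambda>_. c) (faces X 0) |c. True}"

(* (u, v) \<in> r is read as "u is less than or equal to v". *)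
definition larger_vertex :: "'a set set \<Rightarrow> ('a set \<times> 'a set) set \<Rightarrow> 'a set \<Rightarrow> 'a set" where
  "larger_vertex X r e =
     (THE v. v \<in> faces X 0 \<and> v \<subseteq> e \<and> (\<forall>u\<in>faces X 0. u \<subseteq> e \<longrightarrow> (u, v) \<in> r))"

definition smaller_vertex :: "'a set set \<Rightarrow> ('a set \<times> 'a set) set \<Rightarrow> 'a set \<Rightarrow> 'a set" where
  "smaller_vertex X r e =
     (THE v. v \<in> faces X 0 \<and> v \<subseteq> e \<and> (\<forall>u\<in>faces X 0. u \<subseteq> e \<longrightarrow> (v, u) \<in> r))"

definition d0 ::
  "'a set set \<Rightarrow> ('a set \<times> 'a set) set \<Rightarrow> ('a set \<Rightarrow> 'r::ab_group_add) \<Rightarrow> 'a set \<Rightarrow> 'r" where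
  "d0 X r f = (\<lambda>e\<in>faces X 1. f (larger_vertex X r e) - f (smaller_vertex X r e))"

definition cochain_norm ::
  "'a set set \<Rightarrow> ('a set \<Rightarrow> real) \<Rightarrow> nat \<Rightarrow> ('a set \<Rightarrow> 'r::ab_group_add) \<Rightarrow> real" where
  "cochain_norm X w i f = weight w {x \<in> faces X i. f x \<noteq> 0}"

(* The group may be infinite, but the set of norms below is always finite,
   as each of them is the weight of a set of vertices. *)
definition dist_constants ::
  "'a set set \<Rightarrow> ('a set \<Rightarrow> real) \<Rightarrow> ('a set \<Rightarrow> 'r::ab_group_add) \<Rightarrow> real" where
  "dist_constants X w f =
     Min {cochain_norm X w 0 (\<lambda>v\<in>faces X 0. f v - g v) |g. g \<in> constants X}"

(* The coefficient group is the type 'r, passed as an itself argument. The supremum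
   is taken in the extended reals, so that it is meaningful without knowing
   beforehand that the set of admissible constants is bounded. *)
definition cbe0 ::
  "'a set set \<Rightarrow> ('a set \<Rightarrow> real) \<Rightarrow> ('a set \<times> 'a set) set \<Rightarrow> 'r::ab_group_add itself \<Rightarrow> ereal"
  where
  "cbe0 X w r (R :: 'r::ab_group_add itself) =
     Sup {ereal \<epsilon> |\<epsilon>. 0 \<le> \<epsilon> \<and>
       (\<forall>f \<in> (cochains X 0 :: ('a set \<Rightarrow> 'r) set).
          \<epsilon> * dist_constants X w f \<le> cochain_norm X w 1 (d0 X r f))}"

end

(* For f in C^0 the coboundary d_0 f is supported exactly on the edges that join different level
   sets of f. Counting every such edge once from each of its ends and applying h' to each level
   set A_c gives |d_0 f| >= h' * (sum over c of w(A_c) (1 - w(A_c))), and 1 - w(A_c) is the distance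
   of f to the constant c; since the numbers w(A_c) sum to 1, the bound h' <= cbe_0 follows.
   Testing on x times the indicator of A, whose distance to the constants is
   min(w(A), 1 - w(A)), gives cbe_0 <= h, and w(A) (1 - w(A)) <= min(w(A), 1 - w(A)) gives
   h <= 2 h'. *)
theory Submission
  imports Defs
begin

text \<open>Naming the two elements in increasing order as \<open>s\<close> and \<open>t\<close>
  treats both orientations of an edge at once. The last clause, an instance of antisymmetry,
  supplies the uniqueness needed for the definite descriptions of the larger and smaller
  vertex.\<close>

lemma ordered_doubletonE:
  assumes r: "linear_order_on V r" and uv: "u \<in> V" "v \<in> V"
  obtains s t where "{s, t} = {u, v}" "(s, s) \<in> r" "(t, t) \<in> r" "(s, t) \<in> r"
    "(t, s) \<in> r \<longrightarrow> s = t"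
proof -
  have "refl_on V r" and anti: "antisym r" and tot: "total_on V r"
    using r by (simp_all add: linear_order_on_def partial_order_on_def preorder_on_def)
  then have refl: "(u, u) \<in> r" "(v, v) \<in> r"
    using uv by (simp_all add: refl_on_def)
  then consider "(u, v) \<in> r" | "(v, u) \<in> r"
    using tot uv unfolding total_on_def by metis
  then show ?thesis
  proof cases
    case 1
    with refl antisymD[OF anti, of u v] show ?thesis by (intro that[of u v]) simp_all
  next
    case 2
    with refl antisymD[OF anti, of v u] show ?thesis
      by (intro that[of v u]) (simp_all add: insert_commute)
  qed
qed

section \<open>Vertices, edges and weights of vertex sets\<close>

locale wgraph =
  fixes X :: "'a set set" and w :: "'a set \<Rightarrow> real"
  assumes wg: "weighted_graph X w"
begin

abbreviation "V \<equiv> faces X 0"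
abbreviation "E \<equiv> faces X 1"
abbreviation "edge_cut A \<equiv> edges_between X A (V - A)"

lemma face_subset: "x \<in> X \<Longrightarrow> y \<subseteq> x \<Longrightarrow> y \<in> X"
  using wg unfolding weighted_graph_def graph_def simplicial_complex_def by blast

lemma finite_faces [simp]: "finite (faces X i)"
  using wg unfolding weighted_graph_def graph_def simplicial_complex_def faces_def by auto

lemma vertex_pos: "v \<in> V \<Longrightarrow> 0 < w v"
  using wg unfolding weighted_graph_def by blast

lemma edge_nonneg: "e \<in> E \<Longrightarrow> 0 \<le> w e"
  using wg unfolding weighted_graph_def faces_def by blast

lemma edge_weights: "(\<Sum>e\<in>E. w e) = 1"
  using wg unfolding weighted_graph_def by blast

lemma edgeE:
  assumes "e \<in> E"
  obtains a b where "e = {a, b}" "a \<noteq> b" "{a} \<in> V" "{b} \<in> V"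
proof -
  have "e \<in> X" "card e = 2" using assms by (auto simp: faces_def)
  then obtain a b where "e = {a, b}" "a \<noteq> b" by (meson card_2_iff)
  moreover from this have "{a} \<in> V" "{b} \<in> V"
    using face_subset[OF \<open>e \<in> X\<close>] by (auto simp: faces_def)
  ultimately show ?thesis using that by blast
qed

lemma vertices_of_doubleton:
  assumes "{a} \<in> V" "{b} \<in> V"
  shows "{v \<in> V. v \<subseteq> {a, b}} = {{a}, {b}}"
proof
  show "{v \<in> V. v \<subseteq> {a, b}} \<subseteq> {{a}, {b}}"
  proof
    fix v assume v: "v \<in> {v \<in> V. v \<subseteq> {a, b}}"
    then have "card v = 1" by (simp add: faces_def)
    then obtain c where "v = {c}" by (rule card_1_singletonE)
    then show "v \<in> {{a}, {b}}" using v by auto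
  qed
  show "{{a}, {b}} \<subseteq> {v \<in> V. v \<subseteq> {a, b}}" using assms by simp
qed

text \<open>Double counting of incident pairs of a vertex and an edge: each edge is counted from
  both of its ends, which cancels the factor 1/2 in the vertex weights.\<close>

lemma total_weight: "weight w V = 1"
proof -
  have "weight w V = (\<Sum>v\<in>V. 1 / 2 * (\<Sum>e\<in>{e \<in> E. v \<subseteq> e}. w e))"
    using wg unfolding weighted_graph_def weight_def by (intro sum.cong) auto
  also have "\<dots> = 1 / 2 * (\<Sum>v\<in>V. \<Sum>e\<in>{e \<in> E. v \<subseteq> e}. w e)"
    by (simp add: sum_distrib_left)
  also have "(\<Sum>v\<in>V. \<Sum>e\<in>{e \<in> E. v \<subseteq> e}. w e) = (\<Sum>e\<in>E. \<Sum>v\<in>{v \<in> V. v \<subseteq> e}. w e)"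
    by (rule sum.swap_restrict) auto
  also have "\<dots> = (\<Sum>e\<in>E. 2 * w e)"
  proof (rule sum.cong[OF refl])
    fix e assume "e \<in> E"
    then obtain a b where "e = {a, b}" "a \<noteq> b" "{a} \<in> V" "{b} \<in> V" by (rule edgeE)
    then have "{v \<in> V. v \<subseteq> e} = {{a}, {b}}" using vertices_of_doubleton[of a b] by simp
    then show "(\<Sum>v\<in>{v \<in> V. v \<subseteq> e}. w e) = 2 * w e" using \<open>a \<noteq> b\<close> by simp
  qed
  also have "\<dots> = 2" using edge_weights by (simp flip: sum_distrib_left)
  finally show ?thesis by simp
qed

lemma weight_mono: "A \<subseteq> B \<Longrightarrow> B \<subseteq> V \<Longrightarrow> weight w A \<le> weight w B"
  unfolding weight_def
  by (rule sum_mono2) (use finite_subset[of B V] vertex_pos in \<open>auto simp: less_imp_le\<close>)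

lemma weight_pos: "A \<subseteq> V \<Longrightarrow> A \<noteq> {} \<Longrightarrow> 0 < weight w A"
  unfolding weight_def
  by (rule sum_pos) (use finite_subset[of A V] vertex_pos in auto)

lemma weight_compl: "A \<subseteq> V \<Longrightarrow> weight w (V - A) = 1 - weight w A"
  using total_weight unfolding weight_def
  by (simp add: sum_diff finite_subset[of A V])

lemma weight_cut_nonneg: "0 \<le> weight w (edge_cut A)"
  unfolding weight_def edges_between_def by (rule sum_nonneg) (auto intro: edge_nonneg)

section \<open>Edges in a cut and in the support of a coboundary\<close>

lemma mem_cut:
  assumes "A \<subseteq> V" "{a, b} \<in> E" "{a} \<in> V" "{b} \<in> V"
  shows "{a, b} \<in> edge_cut A \<longleftrightarrow> ({a} \<in> A) \<noteq> ({b} \<in> A)"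
proof -
  have "({a, b} \<in> edge_cut A) \<longleftrightarrow> (\<exists>s\<in>A. \<exists>t\<in>V - A. {a, b} = s \<union> t)"
    using assms by (simp add: edges_between_def)
  also have "\<dots> \<longleftrightarrow> ({a} \<in> A) \<noteq> ({b} \<in> A)"
  proof
    \<comment> \<open>Both \<open>s\<close> and \<open>t\<close> are vertices contained in the edge,
      so each is one of its two ends; they differ because only \<open>s\<close> lies in
      \<open>A\<close>.\<close>
    assume "\<exists>s\<in>A. \<exists>t\<in>V - A. {a, b} = s \<union> t"
    then obtain s t where st: "s \<in> A" "t \<in> V - A" "{a, b} = s \<union> t" by blast
    then have "s \<in> {v \<in> V. v \<subseteq> {a, b}}" "t \<in> {v \<in> V. v \<subseteq> {a, b}}" using assms(1) by auto
    then have "s = {a} \<or> s = {b}" "t = {a} \<or> t = {b}"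
      unfolding vertices_of_doubleton[OF assms(3,4)] by auto
    then show "({a} \<in> A) \<noteq> ({b} \<in> A)" using st(1,2) by auto
  next
    assume "({a} \<in> A) \<noteq> ({b} \<in> A)"
    moreover have "{a, b} = {a} \<union> {b}" "{a, b} = {b} \<union> {a}" by auto
    ultimately show "\<exists>s\<in>A. \<exists>t\<in>V - A. {a, b} = s \<union> t" using assms by blast
  qed
  finally show ?thesis .
qed

text \<open>Exchanging the two ends only changes the sign of the difference, so whether it vanishes
  does not depend on the chosen order.\<close>

lemma d0_nonzero_iff:
  fixes f :: "'a set \<Rightarrow> 'r::ab_group_add"
  assumes r: "linear_order_on V r" and e: "{a, b} \<in> E" "{a} \<in> V" "{b} \<in> V"
  shows "d0 X r f {a, b} \<noteq> 0 \<longleftrightarrow> f {a} \<noteq> f {b}"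
proof -
  obtain s t where st: "{s, t} = {{a}, {b}}" "(s, s) \<in> r" "(t, t) \<in> r" "(s, t) \<in> r"
    "(t, s) \<in> r \<longrightarrow> s = t"
    using ordered_doubletonE[OF r e(2,3)] .
  \<comment> \<open>\<open>mem\<close> and \<open>all\<close> reduce the conditions under
    \<open>THE\<close> to conditions on \<open>s\<close> and \<open>t\<close> alone.\<close>
  have mem: "v \<in> V \<and> v \<subseteq> {a, b} \<longleftrightarrow> v \<in> {s, t}" for v
    unfolding st(1) vertices_of_doubleton[OF e(2,3), symmetric] by simp
  have all: "(\<forall>u\<in>V. u \<subseteq> {a, b} \<longrightarrow> P u) \<longleftrightarrow> P s \<and> P t" for P
  proof -
    have "(\<forall>u\<in>V. u \<subseteq> {a, b} \<longrightarrow> P u) \<longleftrightarrow> (\<forall>u\<in>{s, t}. P u)"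
      unfolding st(1) vertices_of_doubleton[OF e(2,3), symmetric] by auto
    then show ?thesis by simp
  qed
  have "larger_vertex X r {a, b} = t"
    unfolding larger_vertex_def all conj_assoc[symmetric] mem
    by (rule the_equality) (use st(2-) in auto)
  moreover have "smaller_vertex X r {a, b} = s"
    unfolding smaller_vertex_def all conj_assoc[symmetric] mem
    by (rule the_equality) (use st(2-) in auto)
  ultimately have "d0 X r f {a, b} = f t - f s" using e by (simp add: d0_def)
  then show ?thesis using st(1) by (auto simp: doubleton_eq_iff)
qed

section \<open>Cheeger constants as minima over proper vertex sets\<close>

lemma finite_cuts: "finite {F A |A. A \<noteq> {} \<and> A \<subset> V}"
  by (rule finite_subset[of _ "F ` Pow V"]) auto

text \<open>The edge weights sum to 1, so there is an edge, and one of its two distinct ends forms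
  such a set. Together with finiteness this makes both minima genuine.\<close>

lemma ex_proper_subset: "\<exists>A. A \<noteq> {} \<and> A \<subset> V"
proof -
  have "E \<noteq> {}" using edge_weights by auto
  then obtain e where "e \<in> E" by blast
  then show ?thesis
  proof (rule edgeE)
    fix a b assume "a \<noteq> b" "{a} \<in> V" "{b} \<in> V"
    then have "{{a}} \<noteq> {} \<and> {{a}} \<subset> V" by auto
    then show ?thesis by blast
  qed
qed

lemma cheeger_le:
  assumes "A \<noteq> {}" "A \<subset> V"
  shows "cheeger X w \<le> weight w (edge_cut A) / min (weight w A) (1 - weight w A)"
proof -
  have "cheeger X w \<le> weight w (edge_cut A) / min (weight w A) (weight w (V - A))"
    unfolding cheeger_def by (rule Min_le[OF finite_cuts]) (use assms in blast)
  then show ?thesis using assms by (simp add: weight_compl psubset_imp_subset)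
qed

lemma le_cheeger:
  assumes "\<And>A. A \<noteq> {} \<Longrightarrow> A \<subset> V \<Longrightarrow>
    m \<le> weight w (edge_cut A) / min (weight w A) (1 - weight w A)"
  shows "m \<le> cheeger X w"
  unfolding cheeger_def
proof (rule Min.boundedI[OF finite_cuts], goal_cases)
  case 1
  show ?case using ex_proper_subset by simp
next
  case (2 y)
  then obtain A where "A \<noteq> {}" "A \<subset> V" "y = weight w (edge_cut A) /
      min (weight w A) (weight w (V - A))" by blast
  then show ?case using assms[of A] by (simp add: weight_compl psubset_imp_subset)
qed

lemma cheeger'_le:
  assumes "A \<noteq> {}" "A \<subset> V"
  shows "cheeger' X w \<le> weight w (edge_cut A) / (2 * weight w A * (1 - weight w A))"
proof -
  have "cheeger' X w \<le> weight w (edge_cut A) / (2 * weight w A * weight w (V - A))"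
    unfolding cheeger'_def by (rule Min_le[OF finite_cuts]) (use assms in blast)
  then show ?thesis using assms by (simp add: weight_compl psubset_imp_subset)
qed

lemma le_cheeger':
  assumes "\<And>A. A \<noteq> {} \<Longrightarrow> A \<subset> V \<Longrightarrow>
    m \<le> weight w (edge_cut A) / (2 * weight w A * (1 - weight w A))"
  shows "m \<le> cheeger' X w"
  unfolding cheeger'_def
proof (rule Min.boundedI[OF finite_cuts], goal_cases)
  case 1
  show ?case using ex_proper_subset by simp
next
  case (2 y)
  then obtain A where "A \<noteq> {}" "A \<subset> V" "y = weight w (edge_cut A) /
      (2 * weight w A * weight w (V - A))" by blast
  then show ?case using assms[of A] by (simp add: weight_compl psubset_imp_subset)
qed

text \<open>Both \<open>A\<close> and its complement contain a vertex, and every vertex has positive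
  weight. This keeps the denominators of both Cheeger constants positive.\<close>

lemma weight_proper:
  assumes "A \<noteq> {}" "A \<subset> V"
  shows "0 < weight w A" "weight w A < 1"
  using assms weight_pos[of A] weight_pos[of "V - A"] weight_compl[of A] by auto

section \<open>Comparison of the two Cheeger constants\<close>

lemma half_cheeger_le_cheeger': "1 / 2 * cheeger X w \<le> cheeger' X w"
proof (rule le_cheeger')
  fix A assume A: "A \<noteq> {}" "A \<subset> V"
  define a where "a = weight w A"
  have a: "0 < a" "a < 1" using weight_proper[OF A] by (auto simp: a_def)
  \<comment> \<open>Each factor is at most 1, so the product lies below both. The factor 2 in the
    denominator of \<open>cheeger'\<close> accounts for the 1/2 in the claim.\<close>
  have "a * (1 - a) \<le> a * 1" "a * (1 - a) \<le> 1 * (1 - a)"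
    using a by (intro mult_mono; simp)+
  then have "a * (1 - a) \<le> min a (1 - a)" by simp
  then have "weight w (edge_cut A) / min a (1 - a) \<le> weight w (edge_cut A) / (a * (1 - a))"
    using a weight_cut_nonneg by (intro divide_left_mono) auto
  with cheeger_le[OF A]
  show "1 / 2 * cheeger X w \<le> weight w (edge_cut A) / (2 * weight w A * (1 - weight w A))"
    by (simp add: a_def)
qed

text \<open>Serves both as the sign condition on admissible constants and for multiplying
  inequalities by \<open>cheeger' X w\<close>.\<close>

lemma cheeger'_nonneg: "0 \<le> cheeger' X w"
proof (rule le_cheeger')
  fix A assume "A \<noteq> {}" "A \<subset> V"
  from weight_proper[OF this]
  show "0 \<le> weight w (edge_cut A) / (2 * weight w A * (1 - weight w A))"
    using weight_cut_nonneg by (intro divide_nonneg_nonneg) auto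
qed

text \<open>Clearing the denominator extends the bound to \<open>A = {}\<close> and
  \<open>A = V\<close>, where the left side is 0. The case \<open>A = V\<close> occurs as the level
  set of a constant function.\<close>

lemma cheeger'_mult_le:
  assumes "A \<subseteq> V"
  shows "2 * cheeger' X w * (weight w A * (1 - weight w A)) \<le> weight w (edge_cut A)"
proof (cases "A = {} \<or> A = V")
  case True
  then show ?thesis using weight_cut_nonneg[of A] total_weight by (auto simp: weight_def)
next
  case False
  then have A: "A \<noteq> {}" "A \<subset> V" using assms by auto
  from weight_proper[OF A] have "0 < 2 * weight w A * (1 - weight w A)" by simp
  with cheeger'_le[OF A] show ?thesis by (simp add: pos_le_divide_eq mult_ac)
qed

section \<open>Distance to the constants, and indicator cochains\<close>

lemma dist_constants_eq:
  fixes f :: "'a set \<Rightarrow> 'r::ab_group_add"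
  shows "dist_constants X w f = Min (range (\<lambda>c. weight w {v \<in> V. f v \<noteq> c}))"
proof -
  have "cochain_norm X w 0 (\<lambda>v\<in>V. f v - restrict (\<lambda>_. c) V v) = weight w {v \<in> V. f v \<noteq> c}" for c
    unfolding cochain_norm_def by (rule arg_cong[where f = "weight w"]) auto
  moreover have "(constants X :: ('a set \<Rightarrow> 'r) set) = range (\<lambda>c. restrict (\<lambda>_. c) V)"
    unfolding constants_def by auto
  ultimately show ?thesis
    unfolding dist_constants_def Setcompr_eq_image Collect_mem_eq by (simp only: image_image)
qed

lemma finite_distances: "finite (range (\<lambda>c. weight w {v \<in> V. f v \<noteq> c}))"
  by (rule finite_subset[of _ "weight w ` Pow V"]) auto

lemma dist_constants_le: "dist_constants X w f \<le> 1 - weight w {v \<in> V. f v = c}"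
proof -
  have "V - {v \<in> V. f v = c} = {v \<in> V. f v \<noteq> c}" by auto
  then have "1 - weight w {v \<in> V. f v = c} = weight w {v \<in> V. f v \<noteq> c}"
    using weight_compl[of "{v \<in> V. f v = c}"] by auto
  then show ?thesis
    unfolding dist_constants_eq by (auto intro!: Min_le[OF finite_distances])
qed

lemma cochain_norm_d0_indicator:
  fixes x :: "'r::ab_group_add"
  assumes "linear_order_on V r" "A \<subseteq> V" "x \<noteq> 0"
  shows "cochain_norm X w 1 (d0 X r (\<lambda>v\<in>V. if v \<in> A then x else 0)) = weight w (edge_cut A)"
proof -
  have "e \<in> edge_cut A \<longleftrightarrow> d0 X r (\<lambda>v\<in>V. if v \<in> A then x else 0) e \<noteq> 0" if "e \<in> E" for e
    using that by (rule edgeE) (use that assms in \<open>auto simp: mem_cut d0_nonzero_iff\<close>)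
  moreover have "edge_cut A \<subseteq> E" unfolding edges_between_def by auto
  ultimately show ?thesis
    unfolding cochain_norm_def by (intro arg_cong[where f = "weight w"]) blast
qed

text \<open>A constant other than \<open>x\<close> disagrees with the cochain on all of
  \<open>A\<close>; the constant \<open>x\<close> disagrees with it on all of \<open>V - A\<close>,
  where the cochain is 0.\<close>

lemma le_dist_constants_indicator:
  fixes x :: "'r::ab_group_add"
  assumes "A \<subseteq> V" "x \<noteq> 0"
  shows "min (weight w A) (1 - weight w A) \<le>
    dist_constants X w (\<lambda>v\<in>V. if v \<in> A then x else 0)"
  unfolding dist_constants_eq
proof (rule Min.boundedI[OF finite_distances])
  fix y assume "y \<in> range (\<lambda>c. weight w {v \<in> V. (\<lambda>v\<in>V. if v \<in> A then x else 0) v \<noteq> c})"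
  then obtain c where y: "y = weight w {v \<in> V. (\<lambda>v\<in>V. if v \<in> A then x else 0) v \<noteq> c}" by auto
  show "min (weight w A) (1 - weight w A) \<le> y"
  proof (cases "c = x")
    case False
    then have "weight w A \<le> y" unfolding y using assms by (intro weight_mono) auto
    then show ?thesis by simp
  next
    case True
    then have "weight w (V - A) \<le> y" unfolding y using assms by (intro weight_mono) auto
    then show ?thesis using assms by (simp add: weight_compl)
  qed
qed auto

section \<open>Lower bound for the expansion via level sets\<close>

lemma sum_weight_cut_level_sets:
  fixes f :: "'a set \<Rightarrow> 'r::ab_group_add"
  assumes r: "linear_order_on V r"
  shows "(\<Sum>c\<in>f ` V. weight w (edge_cut {v \<in> V. f v = c})) = 2 * cochain_norm X w 1 (d0 X r f)"
proof -
  have cut: "{e \<in> E. e \<in> edge_cut {v \<in> V. f v = c}} = edge_cut {v \<in> V. f v = c}" for c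
    unfolding edges_between_def by auto
  have "(\<Sum>c\<in>f ` V. weight w (edge_cut {v \<in> V. f v = c}))
      = (\<Sum>c\<in>f ` V. \<Sum>e\<in>{e \<in> E. e \<in> edge_cut {v \<in> V. f v = c}}. w e)"
    unfolding weight_def cut by (rule refl)
  also have "\<dots> = (\<Sum>e\<in>E. \<Sum>c\<in>{c \<in> f ` V. e \<in> edge_cut {v \<in> V. f v = c}}. w e)"
    by (rule sum.swap_restrict) auto
  also have "\<dots> = (\<Sum>e\<in>E. if d0 X r f e \<noteq> 0 then 2 * w e else 0)"
  proof (rule sum.cong[OF refl])
    fix e assume e: "e \<in> E"
    then obtain a b where ab: "e = {a, b}" "{a} \<in> V" "{b} \<in> V" by (rule edgeE)
    have cut_iff: "e \<in> edge_cut {v \<in> V. f v = c} \<longleftrightarrow> (f {a} = c) \<noteq> (f {b} = c)" for c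
      using mem_cut[of "{v \<in> V. f v = c}" a b] e ab by simp
    \<comment> \<open>An edge with different values at its ends is cut by exactly two level sets,
      those of these two values; any other edge is cut by none. Hence the factor 2.\<close>
    have "{c \<in> f ` V. e \<in> edge_cut {v \<in> V. f v = c}}
        = (if f {a} = f {b} then {} else {f {a}, f {b}})"
      unfolding cut_iff using ab by auto
    then show "(\<Sum>c\<in>{c \<in> f ` V. e \<in> edge_cut {v \<in> V. f v = c}}. w e)
        = (if d0 X r f e \<noteq> 0 then 2 * w e else 0)"
      using d0_nonzero_iff[OF r, of a b f] e ab by simp
  qed
  also have "\<dots> = 2 * cochain_norm X w 1 (d0 X r f)"
    unfolding cochain_norm_def weight_def
    by (simp add: sum.inter_filter sum_distrib_left if_distrib cong: if_cong)
  finally show ?thesis .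
qed

lemma cheeger'_mult_dist_le:
  fixes f :: "'a set \<Rightarrow> 'r::ab_group_add"
  assumes r: "linear_order_on V r"
  shows "cheeger' X w * dist_constants X w f \<le> cochain_norm X w 1 (d0 X r f)"
proof -
  define A where "A c = {v \<in> V. f v = c}" for c
  have [simp]: "A c \<subseteq> V" for c by (auto simp: A_def)
  have "(\<Sum>c\<in>f ` V. weight w (A c)) = weight w V"
    unfolding weight_def A_def by (rule sum.image_gen[symmetric]) simp
  \<comment> \<open>The level sets partition \<open>V\<close>, so their weights sum to 1 and the
    distance can be written as a weighted average over them. Each copy is then bounded by the
    distance to the constant of its own level set.\<close>
  then have "2 * (cheeger' X w * dist_constants X w f)
      = (\<Sum>c\<in>f ` V. weight w (A c)) * (2 * cheeger' X w * dist_constants X w f)"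
    using total_weight by simp
  also have "\<dots> = (\<Sum>c\<in>f ` V. 2 * cheeger' X w * (weight w (A c) * dist_constants X w f))"
    by (simp add: sum_distrib_left sum_distrib_right mult_ac)
  also have "\<dots> \<le> (\<Sum>c\<in>f ` V. 2 * cheeger' X w * (weight w (A c) * (1 - weight w (A c))))"
  proof (intro sum_mono mult_left_mono)
    show "dist_constants X w f \<le> 1 - weight w (A c)" for c
      unfolding A_def by (rule dist_constants_le)
    show "0 \<le> weight w (A c)" for c
      using weight_mono[of "{}" "A c"] by (simp add: weight_def)
    show "0 \<le> 2 * cheeger' X w" using cheeger'_nonneg by simp
  qed
  also have "\<dots> \<le> (\<Sum>c\<in>f ` V. weight w (edge_cut (A c)))"
    by (intro sum_mono cheeger'_mult_le) simp
  also have "\<dots> = 2 * cochain_norm X w 1 (d0 X r f)"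
    unfolding A_def by (rule sum_weight_cut_level_sets[OF r])
  finally show ?thesis by simp
qed

section \<open>Upper bound for the expansion via indicator cochains\<close>

lemma admissible_le_cheeger:
  fixes x :: "'r::ab_group_add"
  assumes r: "linear_order_on V r" and x: "x \<noteq> 0" and "0 \<le> \<epsilon>"
    and \<epsilon>: "\<And>f :: 'a set \<Rightarrow> 'r. f \<in> cochains X 0 \<Longrightarrow>
      \<epsilon> * dist_constants X w f \<le> cochain_norm X w 1 (d0 X r f)"
  shows "\<epsilon> \<le> cheeger X w"
proof (rule le_cheeger)
  fix A assume A: "A \<noteq> {}" "A \<subset> V"
  \<comment> \<open>The coboundary of this test cochain is supported exactly on the cut of
    \<open>A\<close>, so the admissibility of \<epsilon> becomes a bound on the Cheeger quotient of
    \<open>A\<close>.\<close>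
  define f where "f = (\<lambda>v\<in>V. if v \<in> A then x else 0)"
  have "\<epsilon> * min (weight w A) (1 - weight w A) \<le> \<epsilon> * dist_constants X w f"
    using A \<open>0 \<le> \<epsilon>\<close> le_dist_constants_indicator[OF _ x, of A]
    by (intro mult_left_mono) (auto simp: f_def)
  also have "\<dots> \<le> cochain_norm X w 1 (d0 X r f)"
    by (rule \<epsilon>) (auto simp: cochains_def f_def)
  also have "\<dots> = weight w (edge_cut A)"
    unfolding f_def using A by (intro cochain_norm_d0_indicator[OF r _ x]) auto
  finally show "\<epsilon> \<le> weight w (edge_cut A) / min (weight w A) (1 - weight w A)"
    using weight_proper[OF A] by (simp add: pos_le_divide_eq)
qed

end

theorem theorem5p2:
  fixes X :: "'a set set" and w :: "'a set \<Rightarrow> real" and r :: "('a set \<times> 'a set) set"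
  assumes "weighted_graph X w"
    and "linear_order_on (faces X 0) r"
    and "\<exists>x :: 'r::ab_group_add. x \<noteq> 0"
  shows "1 / 2 * cheeger X w \<le> cheeger' X w
    \<and> ereal (cheeger' X w) \<le> cbe0 X w r TYPE('r)
    \<and> cbe0 X w r TYPE('r) \<le> ereal (cheeger X w)"
proof -
  interpret wgraph X w by standard (rule assms)
  obtain x :: 'r where x: "x \<noteq> 0" using assms(3) by blast
  show ?thesis
  proof (intro conjI)
    show "1 / 2 * cheeger X w \<le> cheeger' X w" by (rule half_cheeger_le_cheeger')
    show "ereal (cheeger' X w) \<le> cbe0 X w r TYPE('r)"
      unfolding cbe0_def
      \<comment> \<open>\<open>cheeger' X w\<close> is itself an admissible constant, hence below
        the supremum.\<close>
      by (rule Sup_upper) (use cheeger'_nonneg cheeger'_mult_dist_le[OF assms(2)] in blast)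
    show "cbe0 X w r TYPE('r) \<le> ereal (cheeger X w)"
      unfolding cbe0_def
      by (rule Sup_least) (use admissible_le_cheeger[OF assms(2) x] in auto)
  qed
qed

end
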